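(* Let $\Omega\subset\mathbb{R}^d$, $\Gamma$, $\Omega^-$, $\Omega^+$ and $\beta$ be as described in the context, and suppose the following three assumptions hold. (A1) The sub-domain $\Omega^-$ is the intersection of the interiors of finitely many oriented, smooth, embedded manifolds $M_1, M_2, \ldots, M_n$, where $M_i \cap M_j$ is of measure zero whenever $i \neq j$, $i,j\in\{1,\ldots,n\}$. (A2) There exists an open neighborhood $U\subset\mathbb{R}^d$ of $\Gamma$ such that for each $i\in\{1,\ldots,n\}$ there exists a function $\psi_i: U\to\mathbb{R}$ with $\psi_i\in C^2(\overline{U})$ and $$\psi_i(x)=0 \text{ if } x\in M_i\cap\Gamma,\qquad \psi_i(x)>0 \text{ if } x\in U\cap\Omega^-,\qquad \partial_{\bm{n}}\psi_i\neq 0 \text{ on } M_i\cap\Gamma.$$ (A3) There exist positive constants $c_1,\ldots,c_n$ such that $\psi_i(x)>c_i$ for all $x\in\partial U\cap\overline{\Omega^-}$ and for all $i\in\{1,\ldots,n\}$. Define $\psi:U\to\mathbb{R}$ by $\psi(x)=\prod_{i=1}^n\psi_i(x)$. For any constant $c$ such that $0<c<\prod_{i=1}^n c_i$, let $L_c:=\{x\in U:\psi(x)\geq c\}$. Then the function $\phi:\overline{\Omega}\to\mathbb{R}$ given by $$\phi(x)=\begin{cases} c^3, & \text{if } x\in(\overline{\Omega^-}\setminus U)\cup(\overline{\Omega^-}\cap L_c),\\ c^3-(c-\psi(x))^3, & \text{if } x\in (U\cap\overline{\Omega^-})\setminus L_c,\\ 0, & \text{if } x\in\overline{\Omega^+},\end{cases}$$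 is well-defined (i.e. the three cases cover $\overline{\Omega}$ and prescribe consistent values) and satisfies $$\phi\in C(\overline{\Omega}),\quad \phi|_{\Omega^+}\in C^2(\overline{\Omega^+}),\quad \phi|_{\Omega^-}\in C^2(\overline{\Omega^-}),\quad [\phi]_\Gamma=0,\quad [\beta\partial_{\bm{n}}\phi]_\Gamma\neq 0 \text{ a.e. on } \Gamma.$$
   Context: $\Omega\subset\mathbb{R}^d$ ($d=2,3$) is a bounded domain with Lipschitz continuous boundary $\partial\Omega$. $\Gamma\subset\Omega$ is an oriented embedded interface which divides $\Omega$ into two non-overlapping subdomains $\Omega^-$ (inside) and $\Omega^+$ (outside) such that $\Omega=\Omega^-\cup\Omega^+\cup\Gamma$ and $\overline{\Omega^+}\cap\overline{\Omega^-}=\Gamma$. The function $\beta$ is a positive piecewise constant on $\Omega\setminus\Gamma$: $\beta=\beta^->0$ in $\Omega^-$ and $\beta=\beta^+>0$ in $\Omega^+$. $\bm{n}$ is the outward unit normal vector of $\Gamma$ (pointing from $\Omega^-$ to $\Omega^+$), and $\partial_{\bm{n}}v(x)=\bm{n}\cdot\nabla v(x)$ is the normal derivative on $\Gamma$. For $x\in\Gamma$ the jumps across $\Gamma$ are $$[v]_\Gamma(x)=\lim_{\tilde x\to x,\ \tilde x\in\Omega^+}v(\tilde x)-\lim_{\tilde x\to x,\ \tilde x\in\Omega^-}v(\tilde x),$$ $$[\beta\partial_{\bm{n}}v]_\Gamma(x)=\beta^+\lim_{\tilde x\to x,\ \tilde x\in\Omega^+}\bm{n}\cdot\nabla v(\tilde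 x)-\beta^-\lim_{\tilde x\to x,\ \tilde x\in\Omega^-}\bm{n}\cdot\nabla v(\tilde x).$$ The manifolds $M_i$ are hypersurfaces in $\mathbb{R}^d$ and the interior of $M_i$ means the open region on its inner side (e.g. an open half-space when $M_i$ is a hyperplane). "Measure zero" for $M_i\cap M_j$ and "a.e. on $\Gamma$" refer to $(d-1)$-dimensional surface measure. For a set $D$, $w\in C^2(\overline{D})$ means that $w$ and its derivatives up to order two extend continuously to $\overline{D}$; values of $\psi_i$ on $\partial U$ are those of this continuous extension.
   Formalization: In (A2), "ψ_i(x)=0 if x∈M_i∩Γ" is taken as "for x∈Γ, ψ_i(x)=0 if and only if x∈M_i"; without the converse the flux-jump claim fails, e.g. concentric spheres M_1 (radius 1, =Γ), M_2 (radius 2) with ψ_1=ψ_2=1−|x|². *)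

theory Defs
  imports "HOL-Analysis.Analysis"
begin

definition domain :: "'a::topological_space set \<Rightarrow> bool" where
  "domain D \<longleftrightarrow> open D \<and> connected D \<and> D \<noteq> {}"

text \<open>Near each boundary point, the set is the strict epigraph, in some direction \<open>e\<close>, of a Lipschitz
  function on the hyperplane orthogonal to \<open>e\<close>.\<close>

definition lipschitz_boundary :: "'a::euclidean_space set \<Rightarrow> bool" where
  "lipschitz_boundary D \<longleftrightarrow>
    (\<forall>x\<in>frontier D. \<exists>r>0. \<exists>e \<gamma> L. norm e = 1 \<and> L-lipschitz_on {z. z \<bullet> e = 0} \<gamma> \<and>
       D \<inter> ball x r = {y \<in> ball x r. \<gamma> (y - (y \<bullet> e) *\<^sub>R e) < y \<bullet> e})"

text \<open>\<open>Ck_on k S f\<close> is meant for open \<open>S\<close>; \<open>Ck_closure k D f\<close> says that \<open>f\<close> is of class \<open>C^k\<close> on the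
  open set \<open>D\<close> and that \<open>f\<close> and its (directional, iterated) derivatives of order at most \<open>k\<close> extend
  continuously to the closure of \<open>D\<close>. Neither depends on values of \<open>f\<close> outside the open set.\<close>

primrec Ck_on :: "nat \<Rightarrow> 'a::real_normed_vector set \<Rightarrow> ('a \<Rightarrow> real) \<Rightarrow> bool" where
  "Ck_on 0 S f \<longleftrightarrow> continuous_on S f"
| "Ck_on (Suc k) S f \<longleftrightarrow> (\<forall>x\<in>S. f differentiable (at x)) \<and>
     (\<forall>v. Ck_on k S (\<lambda>x. frechet_derivative f (at x) v))"

definition smooth_on :: "'a::real_normed_vector set \<Rightarrow> ('a \<Rightarrow> real) \<Rightarrow> bool" where
  "smooth_on S f \<longleftrightarrow> (\<forall>k. Ck_on k S f)"

definition extends_continuously :: "'a::topological_space set \<Rightarrow> ('a \<Rightarrow> real) \<Rightarrow> bool" where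
  "extends_continuously D f \<longleftrightarrow> (\<exists>g. continuous_on (closure D) g \<and> (\<forall>x\<in>D. g x = f x))"

primrec Ck_closure :: "nat \<Rightarrow> 'a::real_normed_vector set \<Rightarrow> ('a \<Rightarrow> real) \<Rightarrow> bool" where
  "Ck_closure 0 D f \<longleftrightarrow> extends_continuously D f"
| "Ck_closure (Suc k) D f \<longleftrightarrow> extends_continuously D f \<and> (\<forall>x\<in>D. f differentiable (at x)) \<and>
     (\<forall>v. Ck_closure k D (\<lambda>x. frechet_derivative f (at x) v))"

definition grad :: "(real^'d \<Rightarrow> real) \<Rightarrow> real^'d \<Rightarrow> real^'d" where
  "grad f x = (\<chi> i. frechet_derivative f (at x) (axis i 1))"

text \<open>Hausdorff (outer) measure of integer dimension \<open>s \<ge> 1\<close>, normalised so that it is the usual surface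
  measure on \<open>s\<close>-dimensional surfaces.\<close>

definition hausdorff_measure :: "nat \<Rightarrow> 'a::metric_space set \<Rightarrow> ennreal" where
  "hausdorff_measure s S =
    (SUP \<delta>\<in>{0::real<..}.
       INF C\<in>{C. S \<subseteq> (\<Union>k. C k) \<and> (\<forall>k. bounded (C k) \<and> diameter (C k) \<le> \<delta>)}.
         (\<Sum>k::nat. ennreal (unit_ball_vol (real s) * (diameter (C k) / 2) ^ s)))"

definition surface_measure :: "(real^'d) set \<Rightarrow> ennreal" where
  "surface_measure S = hausdorff_measure (CARD('d) - 1) S"

definition ae_on :: "(real^'d) set \<Rightarrow> (real^'d \<Rightarrow> bool) \<Rightarrow> bool" where
  "ae_on S P \<longleftrightarrow> surface_measure {x \<in> S. \<not> P x} = 0"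

text \<open>A smooth embedded hypersurface \<open>M\<close> together with the open region \<open>I\<close> on its inner side. The
  orientation of \<open>M\<close> is the one whose unit normal points out of \<open>I\<close>. The condition
  \<^term>\<open>frontier I = M\<close> expresses that \<open>M\<close> is all of the boundary of its interior; the local defining
  functions give that \<open>M\<close> is smooth, embedded, and has \<open>I\<close> on one side only.\<close>

definition oriented_smooth_hypersurface :: "(real^'d) set \<Rightarrow> (real^'d) set \<Rightarrow> bool" where
  "oriented_smooth_hypersurface M I \<longleftrightarrow> open I \<and> frontier I = M \<and>
    (\<forall>x\<in>M. \<exists>V g. open V \<and> x \<in> V \<and> smooth_on V g \<and> (\<forall>y\<in>V. grad g y \<noteq> 0) \<and>
       M \<inter> V = {y \<in> V. g y = 0} \<and> I \<inter> V = {y \<in> V. g y < 0})"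

text \<open>An embedded (locally flat topological) hypersurface with \<open>A\<close> on its inner and \<open>B\<close> on its
  outer side. No smoothness is required, so that polygonal or polyhedral interfaces are included.\<close>

definition oriented_embedded_interface ::
    "'a::euclidean_space set \<Rightarrow> 'a set \<Rightarrow> 'a set \<Rightarrow> bool" where
  "oriented_embedded_interface \<Gamma> A B \<longleftrightarrow>
    (\<forall>x\<in>\<Gamma>. \<exists>V W (h::'a \<Rightarrow> 'a) k e. open V \<and> x \<in> V \<and> open W \<and> homeomorphism V W h k \<and> e \<noteq> 0 \<and>
       h ` (\<Gamma> \<inter> V) = {z \<in> W. z \<bullet> e = 0} \<and>
       h ` (A \<inter> V) = {z \<in> W. z \<bullet> e < 0} \<and>
       h ` (B \<inter> V) = {z \<in> W. z \<bullet> e > 0})"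

text \<open>\<open>\<nu>\<close> is the unit normal of \<open>\<Gamma>\<close> at \<open>x\<close> pointing from \<open>A\<close> to \<open>B\<close>. It exists only where \<open>\<Gamma>\<close> is a
  \<open>C^1\<close> hypersurface near \<open>x\<close>, hence not at corners or edges.\<close>

definition unit_normal_at ::
    "(real^'d) set \<Rightarrow> (real^'d) set \<Rightarrow> (real^'d) set \<Rightarrow> real^'d \<Rightarrow> real^'d \<Rightarrow> bool" where
  "unit_normal_at \<Gamma> A B x \<nu> \<longleftrightarrow>
    (\<exists>V g. open V \<and> x \<in> V \<and> Ck_on 1 V g \<and> (\<forall>y\<in>V. grad g y \<noteq> 0) \<and>
       \<Gamma> \<inter> V = {y \<in> V. g y = 0} \<and> A \<inter> V = {y \<in> V. g y < 0} \<and> B \<inter> V = {y \<in> V. g y > 0} \<and>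
       x \<in> \<Gamma> \<and> \<nu> = grad g x /\<^sub>R norm (grad g x))"

definition has_unit_normal ::
    "(real^'d) set \<Rightarrow> (real^'d) set \<Rightarrow> (real^'d) set \<Rightarrow> real^'d \<Rightarrow> bool" where
  "has_unit_normal \<Gamma> A B x \<longleftrightarrow> (\<exists>\<nu>. unit_normal_at \<Gamma> A B x \<nu>)"

text \<open>Jumps as relations, so that the existence of the one-sided limits is part of the assertion. Here
  \<open>A\<close> is the inner and \<open>B\<close> the outer side, and \<open>\<nu>\<close> is the normal at the fixed point \<open>x\<close>.\<close>

definition has_jump ::
    "'a::topological_space set \<Rightarrow> 'a set \<Rightarrow> ('a \<Rightarrow> real) \<Rightarrow> 'a \<Rightarrow> real \<Rightarrow> bool" where
  "has_jump A B v x J \<longleftrightarrow>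
    (\<exists>lp lm. (v \<longlongrightarrow> lp) (at x within B) \<and> (v \<longlongrightarrow> lm) (at x within A) \<and> J = lp - lm)"

definition has_flux_jump ::
    "(real^'d) set \<Rightarrow> (real^'d) set \<Rightarrow> real \<Rightarrow> real \<Rightarrow> real^'d \<Rightarrow> (real^'d \<Rightarrow> real) \<Rightarrow> real^'d \<Rightarrow> real \<Rightarrow> bool" where
  "has_flux_jump A B \<beta>m \<beta>p \<nu> v x J \<longleftrightarrow>
    (\<exists>lp lm. ((\<lambda>y. \<nu> \<bullet> grad v y) \<longlongrightarrow> lp) (at x within B) \<and>
             ((\<lambda>y. \<nu> \<bullet> grad v y) \<longlongrightarrow> lm) (at x within A) \<and> J = \<beta>p * lp - \<beta>m * lm)"

definition superlevel_set :: "'a set \<Rightarrow> ('a \<Rightarrow> real) \<Rightarrow> real \<Rightarrow> 'a set" where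
  "superlevel_set U \<psi> c = {x \<in> U. \<psi> x \<ge> c}"

text \<open>The case distinction defining the function, as a relation: some clause applying to \<open>x\<close> prescribes
  the value \<open>y\<close>. Well-definedness at \<open>x\<close> is then the existence of exactly one such \<open>y\<close>.\<close>

definition prescribed_value ::
    "'a::topological_space set \<Rightarrow> 'a set \<Rightarrow> 'a set \<Rightarrow> ('a \<Rightarrow> real) \<Rightarrow> real \<Rightarrow> 'a \<Rightarrow> real \<Rightarrow> bool" where
  "prescribed_value A B U \<psi> c x y \<longleftrightarrow>
    (x \<in> (closure A - U) \<union> (closure A \<inter> superlevel_set U \<psi> c) \<and> y = c ^ 3) \<or>
    (x \<in> (U \<inter> closure A) - superlevel_set U \<psi> c \<and> y = c ^ 3 - (c - \<psi> x) ^ 3) \<or>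
    (x \<in> closure B \<and> y = 0)"

end

theory Submission
  imports Defs
begin

text \<open>In \<open>U\<close> and the closure of \<open>\<Omega>m\<close>, \<open>\<phi>\<close> is the composition of the product \<open>f\<close> of the \<open>\<psi>\<^sub>i\<close> with the
  cubic \<open>t \<mapsto> c^3 - (c - t)^3\<close>, stopped at \<open>t = c\<close> (\<open>capped_cubic\<close>). There the cubic has an inflection
  point with horizontal tangent, so that the stopped cubic is \<open>C^2\<close> on the real line. By the
  lower bounds \<open>c\<^sub>i\<close> for the \<open>\<psi>\<^sub>i\<close>, \<open>f > c\<close> holds in the part of \<open>U\<close> near each point of \<open>frontier U\<close>
  in the closure of \<open>\<Omega>m\<close> (\<open>prod_gt_near_frontier\<close>), hence the composition is already
  constant before \<open>U\<close> is left, and its continuation by \<open>c^3\<close> is of class \<open>C^2\<close> on an open neighbourhood of the closure of \<open>\<Omega>m\<close> (\<open>Ck_on_capped_extension\<close>). This gives at once the regularity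
  up to the boundary and the limits of \<open>\<phi>\<close> and its gradient from inside.

  A point of \<open>\<Gamma>\<close> lies in the closure of \<open>\<Omega>m\<close> but not in \<open>\<Omega>m\<close>, hence on some \<open>M\<^sub>i\<close>, where \<open>\<psi>\<^sub>i = 0\<close>. So
  \<open>f\<close> and \<open>\<phi>\<close> vanish on \<open>\<Gamma>\<close>, which makes the case distinction consistent and glues \<open>\<phi>\<close> continuously to
  the value \<open>0\<close> outside.

  The double points \<open>M\<^sub>i \<inter> M\<^sub>j\<close> form a null set. Any other point \<open>x\<close> of \<open>\<Gamma>\<close> lies on exactly one \<open>M\<^sub>i\<close> and
  in the interiors of the others, so near \<open>x\<close> the interface is \<open>M\<^sub>i\<close> and has a normal
  (\<open>has_unit_normal_on_single_face\<close>). Only the term with \<open>\<nabla>\<psi>\<^sub>i\<close> survives in the product rule, and the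
  inner gradient at \<open>x\<close> is \<open>3c^2 (\<Prod>j\<noteq>i. \<psi>\<^sub>j) \<nabla>\<psi>\<^sub>i\<close>, with nonzero normal component
  because the other \<open>\<psi>\<^sub>j\<close> do not vanish at \<open>x\<close> and \<open>\<psi>\<^sub>i\<close> has nonzero normal derivative. The
  outer gradient is zero, so the flux jumps.\<close>

section \<open>Calculus of the classes \<open>C^k\<close>\<close>

lemma Ck_on_subset: "Ck_on k T f \<Longrightarrow> S \<subseteq> T \<Longrightarrow> Ck_on k S f"
  by (induction k arbitrary: f) (auto intro: continuous_on_subset)

lemma differentiable_transform_open:
  assumes "f differentiable at x" "open S" "x \<in> S" "\<And>y. y \<in> S \<Longrightarrow> f y = g y"
  shows "g differentiable at x"
proof -
  obtain f' where "(f has_derivative f') (at x)" using assms(1) by (auto simp: differentiable_def)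
  then have "(g has_derivative f') (at x)"
    by (rule has_derivative_transform_within_open[OF _ assms(2,3)]) (rule assms(4))
  then show ?thesis by (auto simp: differentiable_def)
qed

lemma Ck_on_cong:
  assumes "open S" "\<And>x. x \<in> S \<Longrightarrow> f x = g x" "Ck_on k S f"
  shows "Ck_on k S g"
  using assms(2,3)
proof (induction k arbitrary: f g)
  case 0
  then show ?case by (simp cong: continuous_on_cong)
next
  case (Suc k)
  have diff: "f differentiable at x" if "x \<in> S" for x
    using Suc.prems that by simp
  have "g differentiable at x" if "x \<in> S" for x
    by (rule differentiable_transform_open[OF diff[OF that] \<open>open S\<close> that]) (rule Suc.prems(1))
  moreover have "frechet_derivative f (at x) = frechet_derivative g (at x)" if "x \<in> S" for x
    by (rule frechet_derivative_transform_within_open[OF diff[OF that] \<open>open S\<close> that])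
      (rule Suc.prems(1))
  then have "Ck_on k S (\<lambda>x. frechet_derivative g (at x) v)" for v
    using Suc.prems(2)
    by - (rule Suc.IH[of "\<lambda>x. frechet_derivative f (at x) v", rotated], auto)
  ultimately show ?case by simp
qed

text \<open>This glues the pieces of the lifting function, which overlap in open sets.\<close>

lemma Ck_on_local:
  assumes "\<And>x. x \<in> S \<Longrightarrow> \<exists>T. open T \<and> x \<in> T \<and> Ck_on k T f"
  shows "Ck_on k S f"
  using assms
proof (induction k arbitrary: f)
  case 0
  show ?case unfolding Ck_on.simps
  proof (rule continuous_at_imp_continuous_on, rule ballI)
    fix x assume "x \<in> S"
    then obtain T where "open T" "x \<in> T" "continuous_on T f" using 0 by auto
    then show "isCont f x" by (simp add: continuous_on_eq_continuous_at)
  qed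
next
  case (Suc k)
  have "f differentiable at x" if "x \<in> S" for x
    using Suc.prems[OF that] by auto
  moreover have "Ck_on k S (\<lambda>x. frechet_derivative f (at x) v)" for v
    using Suc.prems by (intro Suc.IH) (metis Ck_on.simps(2))
  ultimately show ?case by simp
qed

lemma Ck_on_const: "Ck_on k S (\<lambda>x. a)"
proof (induction k arbitrary: a)
  case (Suc k)
  have "frechet_derivative (\<lambda>x. a) (at x) = (\<lambda>v. 0)" for x :: 'a
    by (rule frechet_derivative_at[symmetric]) simp
  then show ?case using Suc by simp
qed simp

lemma Ck_on_Suc_imp: "Ck_on (Suc k) S f \<Longrightarrow> Ck_on k S f"
proof (induction k arbitrary: f)
  case 0
  then have "isCont f x" if "x \<in> S" for x
    using that differentiable_imp_continuous_within by auto
  then show ?case by (simp add: continuous_at_imp_continuous_on)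
qed simp

lemma Ck_on_antimono: "Ck_on k S f \<Longrightarrow> m \<le> k \<Longrightarrow> Ck_on m S f"
proof (induction k arbitrary: m)
  case (Suc k)
  then show ?case using Ck_on_Suc_imp[OF Suc.prems(1)] le_SucE by blast
qed simp

lemma Ck_on_SucI:
  assumes "open S" "\<And>x. x \<in> S \<Longrightarrow> (f has_derivative f' x) (at x)"
    and "\<And>v. Ck_on k S (\<lambda>x. f' x v)"
  shows "Ck_on (Suc k) S f"
proof -
  have "f' x = frechet_derivative f (at x)" if "x \<in> S" for x
    using assms(2)[OF that] by (rule frechet_derivative_at)
  then have "Ck_on k S (\<lambda>x. frechet_derivative f (at x) v)" for v
    by (intro Ck_on_cong[OF assms(1) _ assms(3)[of v]]) auto
  then show ?thesis using assms(2) by (auto simp: differentiable_def)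
qed

lemma Ck_on_SucD: "Ck_on (Suc k) S f \<Longrightarrow> x \<in> S \<Longrightarrow>
    (f has_derivative frechet_derivative f (at x)) (at x)"
  by (simp add: frechet_derivative_works[symmetric])

lemma Ck_on_add:
  assumes "open S" "Ck_on k S f" "Ck_on k S g"
  shows "Ck_on k S (\<lambda>x. f x + g x)"
  using assms(2,3)
proof (induction k arbitrary: f g)
  case 0
  then show ?case by (auto intro: continuous_intros)
next
  case (Suc k)
  show ?case
  proof (rule Ck_on_SucI[OF \<open>open S\<close>])
    show "((\<lambda>x. f x + g x) has_derivative
        (\<lambda>v. frechet_derivative f (at x) v + frechet_derivative g (at x) v)) (at x)" if "x \<in> S" for x
      using Suc.prems that by (intro has_derivative_add Ck_on_SucD)
    show "Ck_on k S (\<lambda>x. frechet_derivative f (at x) v + frechet_derivative g (at x) v)" for v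
      using Suc.prems by (intro Suc.IH) auto
  qed
qed

lemma Ck_on_mult:
  assumes "open S" "Ck_on k S f" "Ck_on k S g"
  shows "Ck_on k S (\<lambda>x. f x * g x)"
  using assms(2,3)
proof (induction k arbitrary: f g)
  case 0
  then show ?case by (auto intro: continuous_intros)
next
  case (Suc k)
  show ?case
  proof (rule Ck_on_SucI[OF \<open>open S\<close>])
    show "((\<lambda>x. f x * g x) has_derivative
        (\<lambda>v. f x * frechet_derivative g (at x) v + frechet_derivative f (at x) v * g x)) (at x)"
      if "x \<in> S" for x
      using Suc.prems that by (intro has_derivative_mult Ck_on_SucD)
    show "Ck_on k S (\<lambda>x. f x * frechet_derivative g (at x) v + frechet_derivative f (at x) v * g x)"
      for v
      using Suc.prems Suc.prems[THEN Ck_on_Suc_imp]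
      by (intro Ck_on_add[OF \<open>open S\<close>] Suc.IH) auto
  qed
qed

lemma Ck_on_prod:
  assumes "open S" "\<And>i. i \<in> I \<Longrightarrow> Ck_on k S (f i)"
  shows "Ck_on k S (\<lambda>x. \<Prod>i\<in>I. f i x)"
  using assms(2)
  by (induction I rule: infinite_finite_induct) (auto intro: Ck_on_const Ck_on_mult \<open>open S\<close>)

text \<open>One step of the chain rule: a composition gains a derivative whenever the composition with the
  derivative of the outer function has one less.\<close>

lemma Ck_on_compose_Suc:
  assumes "open S" "Ck_on (Suc k) S f" "Ck_on k S (\<lambda>x. F' (f x))"
    and F: "\<And>t. (F has_real_derivative F' t) (at t)"
  shows "Ck_on (Suc k) S (\<lambda>x. F (f x))"
proof (rule Ck_on_SucI[OF \<open>open S\<close>])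
  show "((\<lambda>x. F (f x)) has_derivative (\<lambda>v. frechet_derivative f (at x) v * F' (f x))) (at x)"
    if "x \<in> S" for x
    using F by (rule DERIV_compose_FDERIV[OF _ Ck_on_SucD[OF assms(2) that]])
  show "Ck_on k S (\<lambda>x. frechet_derivative f (at x) v * F' (f x))" for v
    using assms by (intro Ck_on_mult) auto
qed

lemma extends_continuously_imp_continuous_on:
  assumes "extends_continuously D f"
  shows "continuous_on D f"
proof -
  obtain g where g: "continuous_on (closure D) g" "\<And>x. x \<in> D \<Longrightarrow> g x = f x"
    using assms by (auto simp: extends_continuously_def)
  then have "continuous_on D g" using continuous_on_subset closure_subset by blast
  then show ?thesis using g(2) by (simp cong: continuous_on_cong)
qed

lemma Ck_closure_imp_Ck_on: "Ck_closure k D f \<Longrightarrow> Ck_on k D f"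
  by (induction k arbitrary: f) (auto intro: extends_continuously_imp_continuous_on)

text \<open>A function that is regular on a set containing the closure, and each of its derivatives, serves
  as its own continuous extension.\<close>

lemma Ck_on_imp_Ck_closure:
  assumes "Ck_on k W f" "closure D \<subseteq> W"
  shows "Ck_closure k D f"
  using assms(1)
proof (induction k arbitrary: f)
  case 0
  then show ?case using assms(2)
    by (auto simp: extends_continuously_def intro: continuous_on_subset)
next
  case (Suc k)
  have "Ck_on 0 W f"
    using Suc.prems by (rule Ck_on_antimono) simp
  then have "extends_continuously D f" using assms(2)
    by (auto simp: extends_continuously_def intro: continuous_on_subset)
  then show ?case using Suc assms(2) closure_subset[of D] by auto
qed

lemma Ck_closure_cong:
  assumes "open D" "\<And>x. x \<in> D \<Longrightarrow> f x = g x" "Ck_closure k D f"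
  shows "Ck_closure k D g"
  using assms(2,3)
proof (induction k arbitrary: f g)
  case 0
  then show ?case by (simp add: extends_continuously_def)
next
  case (Suc k)
  have diff: "f differentiable at x" if "x \<in> D" for x
    using Suc.prems that by simp
  have "g differentiable at x" if "x \<in> D" for x
    by (rule differentiable_transform_open[OF diff[OF that] \<open>open D\<close> that]) (rule Suc.prems(1))
  moreover have "frechet_derivative f (at x) = frechet_derivative g (at x)" if "x \<in> D" for x
    by (rule frechet_derivative_transform_within_open[OF diff[OF that] \<open>open D\<close> that])
      (rule Suc.prems(1))
  then have "Ck_closure k D (\<lambda>x. frechet_derivative g (at x) v)" for v
    using Suc.prems(2)
    by - (rule Suc.IH[of "\<lambda>x. frechet_derivative f (at x) v", rotated], auto)
  ultimately show ?case using Suc.prems by (simp add: extends_continuously_def)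
qed

lemma grad_cong:
  assumes "f differentiable at x" "open S" "x \<in> S" "\<And>y. y \<in> S \<Longrightarrow> f y = g y"
  shows "grad g x = grad f x"
  using frechet_derivative_transform_within_open[OF assms] by (simp add: grad_def)

lemma continuous_on_grad:
  assumes "Ck_on (Suc k) S f"
  shows "continuous_on S (grad f)"
proof -
  have "Ck_on (Suc 0) S f"
    using assms by (rule Ck_on_antimono) simp
  then show ?thesis unfolding grad_def by (intro continuous_on_vec_lambda) auto
qed

lemma grad_compose:
  assumes "(F has_real_derivative D) (at (f x))" "f differentiable at x"
  shows "grad (\<lambda>y. F (f y)) x = D *\<^sub>R grad f x"
proof -
  have "((\<lambda>y. F (f y)) has_derivative (\<lambda>v. frechet_derivative f (at x) v * D)) (at x)"
    using assms(2)
    by (intro DERIV_compose_FDERIV[where f = F and g = f, OF assms(1)])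
      (simp add: frechet_derivative_works[symmetric])
  then have "frechet_derivative (\<lambda>y. F (f y)) (at x) = (\<lambda>v. frechet_derivative f (at x) v * D)"
    by (rule frechet_derivative_at[symmetric])
  then show ?thesis by (simp add: grad_def vec_eq_iff)
qed

text \<open>In the product rule every term but one contains the vanishing factor undifferentiated.\<close>

lemma grad_prod_of_zero:
  assumes "finite I" "i \<in> I" "f i x = 0" "\<And>j. j \<in> I \<Longrightarrow> f j differentiable at x"
  shows "grad (\<lambda>y. \<Prod>j\<in>I. f j y) x = (\<Prod>j\<in>I - {i}. f j x) *\<^sub>R grad (f i) x"
proof -
  let ?d = "\<lambda>j. frechet_derivative (f j) (at x)"
  have "((\<lambda>y. \<Prod>j\<in>I. f j y) has_derivative (\<lambda>v. \<Sum>j\<in>I. ?d j v * (\<Prod>k\<in>I - {j}. f k x))) (at x)"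
    using assms(4) by (intro has_derivative_prod) (simp add: frechet_derivative_works[symmetric])
  then have "frechet_derivative (\<lambda>y. \<Prod>j\<in>I. f j y) (at x) =
      (\<lambda>v. \<Sum>j\<in>I. ?d j v * (\<Prod>k\<in>I - {j}. f k x))"
    by (rule frechet_derivative_at[symmetric])
  also have "\<dots> = (\<lambda>v. ?d i v * (\<Prod>k\<in>I - {i}. f k x))"
  proof
    fix v
    have "(\<Prod>k\<in>I - {j}. f k x) = 0" if "j \<in> I - {i}" for j
      using assms that by (intro prod_zero) auto
    then have "(\<Sum>j\<in>I - {i}. ?d j v * (\<Prod>k\<in>I - {j}. f k x)) = 0"
      by (intro sum.neutral ballI) (simp only: mult_zero_right)
    then show "(\<Sum>j\<in>I. ?d j v * (\<Prod>k\<in>I - {j}. f k x)) = ?d i v * (\<Prod>k\<in>I - {i}. f k x)"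
      using assms(1,2) by (simp add: sum.remove[of I i])
  qed
  finally show ?thesis by (simp add: grad_def vec_eq_iff)
qed

section \<open>Hausdorff null sets\<close>

lemma hausdorff_measure_mono: "S \<subseteq> T \<Longrightarrow> hausdorff_measure s S \<le> hausdorff_measure s T"
  unfolding hausdorff_measure_def
  by (intro SUP_mono' INF_superset_mono) auto

lemma hausdorff_measure_eq_0_iff:
  "hausdorff_measure s S = 0 \<longleftrightarrow>
    (\<forall>\<delta>>0. \<forall>\<epsilon>>0. \<exists>C. S \<subseteq> (\<Union>k. C k) \<and> (\<forall>k. bounded (C k) \<and> diameter (C k) \<le> \<delta>) \<and>
       (\<Sum>k. ennreal (unit_ball_vol (real s) * (diameter (C k) / 2) ^ s)) < ennreal \<epsilon>)"
  (is "_ \<longleftrightarrow> (\<forall>\<delta>>0. \<forall>\<epsilon>>0. \<exists>C. ?cov \<delta> C \<and> ?bd \<delta> C \<and> ?w C < _)")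
proof -
  have INF0: "(INF C\<in>{C. ?cov \<delta> C \<and> ?bd \<delta> C}. ?w C) = 0 \<longleftrightarrow>
      (\<forall>\<epsilon>>0. \<exists>C. ?cov \<delta> C \<and> ?bd \<delta> C \<and> ?w C < ennreal \<epsilon>)" (is "?I = 0 \<longleftrightarrow> ?R") for \<delta> :: real
  proof
    assume "?I = 0"
    then have "?I < ennreal \<epsilon>" if "\<epsilon> > 0" for \<epsilon> using that by simp
    then show ?R unfolding INF_less_iff by auto
  next
    assume ?R
    then have "?I < ennreal \<epsilon>" if "\<epsilon> > 0" for \<epsilon> using that unfolding INF_less_iff by auto
    then have "?I \<le> 0 + ennreal \<epsilon>" if "\<epsilon> > 0" for \<epsilon> using that less_imp_le by fastforce
    then have "?I \<le> 0" by (rule ennreal_le_epsilon)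
    then show "?I = 0" by simp
  qed
  have "hausdorff_measure s S = 0 \<longleftrightarrow> (\<forall>\<delta>>0. (INF C\<in>{C. ?cov \<delta> C \<and> ?bd \<delta> C}. ?w C) = 0)"
    unfolding hausdorff_measure_def bot_ennreal[symmetric] SUP_bot_conv by auto
  then show ?thesis unfolding INF0 by blast
qed

text \<open>The dimension must be positive: the weight of an empty covering set contains \<open>0 ^ s\<close>, which is
  \<open>1\<close> for \<open>s = 0\<close>.\<close>

lemma hausdorff_measure_empty:
  assumes "s \<ge> 1"
  shows "hausdorff_measure s {} = 0"
  unfolding hausdorff_measure_eq_0_iff
  using assms by (intro allI impI exI[of _ "\<lambda>k. {}"]) (auto simp: power_0_left)

text \<open>Countable subadditivity for null sets: cover the \<open>i\<close>-th set with total weight below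
  \<open>\<epsilon> / 2^(i+1)\<close> and enumerate the resulting double sequence of covering sets.\<close>

lemma hausdorff_measure_UN_eq_0:
  fixes A :: "nat \<Rightarrow> 'a::metric_space set"
  assumes "\<And>i. hausdorff_measure s (A i) = 0"
  shows "hausdorff_measure s (\<Union>i. A i) = 0"
  unfolding hausdorff_measure_eq_0_iff
proof (intro allI impI)
  fix \<delta> \<epsilon> :: real assume "\<delta> > 0" "\<epsilon> > 0"
  define w :: "'a set \<Rightarrow> ennreal"
    where "w D = ennreal (unit_ball_vol (real s) * (diameter D / 2) ^ s)" for D
  define e where "e i = \<epsilon> / 2 * (1/2) ^ Suc i" for i
  have e: "e i > 0" for i using \<open>\<epsilon> > 0\<close> by (simp add: e_def)
  have "e sums (\<epsilon> / 2)"
    using sums_mult[OF power_half_series, of "\<epsilon> / 2"] unfolding e_def[abs_def] by simp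
  have "\<exists>C. A i \<subseteq> (\<Union>k. C k) \<and> (\<forall>k. bounded (C k) \<and> diameter (C k) \<le> \<delta>) \<and> (\<Sum>k. w (C k)) < ennreal (e i)"
    for i
    using assms[of i, unfolded hausdorff_measure_eq_0_iff] \<open>\<delta> > 0\<close> e unfolding w_def by blast
  then obtain C where C: "\<And>i. A i \<subseteq> (\<Union>k. C i k)"
      "\<And>i k. bounded (C i k) \<and> diameter (C i k) \<le> \<delta>"
      "\<And>i. (\<Sum>k. w (C i k)) < ennreal (e i)"
    by metis
  define D where "D m = (case prod_decode m of (i, k) \<Rightarrow> C i k)" for m
  have "D (prod_encode (i, k)) = C i k" for i k by (simp add: D_def)
  then have "C i k \<subseteq> (\<Union>m. D m)" for i k
    using UN_upper[of "prod_encode (i, k)" UNIV D] by simp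
  then have "(\<Union>k. C i k) \<subseteq> (\<Union>m. D m)" for i by (intro UN_least)
  with C(1) have "(\<Union>i. A i) \<subseteq> (\<Union>m. D m)" by (intro UN_least) (rule order_trans)
  moreover have "bounded (D m) \<and> diameter (D m) \<le> \<delta>" for m
    using C(2) by (simp add: D_def split: prod.split)
  moreover have "(\<Sum>m. w (D m)) < ennreal \<epsilon>"
  proof -
    have "(\<Sum>m. w (D m)) = (\<Sum>m. (\<lambda>(i, k). w (C i k)) (prod_decode m))"
      by (simp add: D_def case_prod_beta)
    also have "\<dots> = (\<Sum>i. \<Sum>k. w (C i k))"
      by (rule suminf_ennreal_2dimen) simp
    also have "\<dots> \<le> (\<Sum>i. ennreal (e i))"
      using C(3) by (intro suminf_le) (auto intro: less_imp_le)
    also have "\<dots> = ennreal (\<epsilon> / 2)"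
      using \<open>e sums _\<close> e by (intro suminf_ennreal_eq) (auto intro: less_imp_le)
    also have "\<dots> < ennreal \<epsilon>" using \<open>\<epsilon> > 0\<close> by (simp add: ennreal_less_iff)
    finally show ?thesis .
  qed
  ultimately show "\<exists>C. (\<Union>i. A i) \<subseteq> (\<Union>k. C k) \<and> (\<forall>k. bounded (C k) \<and> diameter (C k) \<le> \<delta>) \<and>
      (\<Sum>k. ennreal (unit_ball_vol (real s) * (diameter (C k) / 2) ^ s)) < ennreal \<epsilon>"
    unfolding w_def by blast
qed

section \<open>The capped cubic\<close>

text \<open>Only \<open>t = 0\<close> needs an argument: there the difference quotient is itself a truncated power, of
  positive exponent, and so tends to \<open>0\<close>.\<close>

lemma has_real_derivative_truncated_power:
  "((\<lambda>t. max 0 t ^ (m + 2)) has_real_derivative (real (m + 2) * max 0 t ^ (m + 1))) (at t)"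
proof -
  consider "t > 0" | "t < 0" | "t = 0" by linarith
  then show ?thesis
  proof cases
    case 1
    have "((\<lambda>t. t ^ (m + 2)) has_real_derivative (real (m + 2) * max 0 t ^ (m + 1))) (at t)"
      using 1 DERIV_pow[of "m + 2" t] by (simp add: max_def)
    then show ?thesis
      by (rule has_field_derivative_transform_within_open[of _ _ _ "{0<..}"]) (use 1 in auto)
  next
    case 2
    have "((\<lambda>t. 0) has_real_derivative (real (m + 2) * max 0 t ^ (m + 1))) (at t)"
      using 2 by simp
    then show ?thesis
      by (rule has_field_derivative_transform_within_open[of _ _ _ "{..<0}"]) (use 2 in auto)
  next
    case 3
    have "((\<lambda>y::real. max 0 y ^ (m + 1)) \<longlongrightarrow> max 0 0 ^ (m + 1)) (at 0)"
      by (intro tendsto_intros)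
    moreover have "max 0 y ^ (m + 1) = (max 0 y ^ (m + 2) - max 0 0 ^ (m + 2)) / (y - 0)"
      if "y \<noteq> 0" for y :: real
      using that by (cases "y > 0") auto
    ultimately have "((\<lambda>y::real. (max 0 y ^ (m + 2) - max 0 0 ^ (m + 2)) / (y - 0)) \<longlongrightarrow>
        max 0 0 ^ (m + 1)) (at 0)"
      by (rule Lim_transform_within[OF _ zero_less_one]) simp
    then show ?thesis unfolding 3 has_field_derivative_iff by simp
  qed
qed

text \<open>The truncation expresses that the cubic \<open>c^3 - (c - t)^3\<close> is stopped at its maximal value \<open>c^3\<close> on
  \<open>t \<le> c\<close>, attained at the inflection point \<open>t = c\<close>.\<close>

definition capped_cubic :: "real \<Rightarrow> real \<Rightarrow> real" where
  "capped_cubic c t = c ^ 3 - max 0 (c - t) ^ 3"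

lemma capped_cubic_of_ge: "t \<ge> c \<Longrightarrow> capped_cubic c t = c ^ 3"
  by (simp add: capped_cubic_def max_def)

lemma capped_cubic_of_le: "t \<le> c \<Longrightarrow> capped_cubic c t = c ^ 3 - (c - t) ^ 3"
  by (simp add: capped_cubic_def max_def)

lemma has_real_derivative_capped_cubic:
  "(capped_cubic c has_real_derivative 3 * max 0 (c - t) ^ 2) (at t)"
proof -
  have "((\<lambda>t. max 0 (c - t) ^ 3) has_real_derivative 3 * max 0 (c - t) ^ 2 * (-1)) (at t)"
  proof (rule DERIV_chain2[where f = "\<lambda>t. max 0 t ^ 3" and g = "\<lambda>t. c - t"])
    show "((\<lambda>t. max 0 t ^ 3) has_real_derivative 3 * max 0 (c - t) ^ 2) (at (c - t))"
      using has_real_derivative_truncated_power[of 1 "c - t"] by (simp add: eval_nat_numeral)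
  qed (auto intro!: derivative_eq_intros)
  from DERIV_diff[OF DERIV_const this] show ?thesis unfolding capped_cubic_def[abs_def] by simp
qed

lemma has_real_derivative_capped_cubic':
  "((\<lambda>t. 3 * max 0 (c - t) ^ 2) has_real_derivative - 6 * max 0 (c - t)) (at t)"
proof -
  have "((\<lambda>t. max 0 (c - t) ^ 2) has_real_derivative 2 * max 0 (c - t) * (-1)) (at t)"
  proof (rule DERIV_chain2[where f = "\<lambda>t. max 0 t ^ 2" and g = "\<lambda>t. c - t"])
    show "((\<lambda>t. max 0 t ^ 2) has_real_derivative 2 * max 0 (c - t)) (at (c - t))"
      using has_real_derivative_truncated_power[of 0 "c - t"] by (simp add: eval_nat_numeral)
  qed (auto intro!: derivative_eq_intros)
  from DERIV_cmult[OF this, of 3] show ?thesis by simp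
qed

lemma Ck_on_capped_cubic:
  assumes "open S" "Ck_on 2 S f"
  shows "Ck_on 2 S (\<lambda>x. capped_cubic c (f x))"
proof -
  have f: "Ck_on (Suc (Suc 0)) S f" "Ck_on (Suc 0) S f" "continuous_on S f"
    using assms(2) Ck_on_antimono[OF assms(2), of "Suc 0"] Ck_on_antimono[OF assms(2), of 0]
    unfolding numeral_2_eq_2 by simp_all
  have "Ck_on 0 S (\<lambda>x. - 6 * max 0 (c - f x))"
    unfolding Ck_on.simps by (intro continuous_intros f(3))
  then have "Ck_on (Suc 0) S (\<lambda>x. 3 * max 0 (c - f x) ^ 2)"
    by (rule Ck_on_compose_Suc[where F = "\<lambda>t. 3 * max 0 (c - t) ^ 2" and F' = "\<lambda>t. - 6 * max 0 (c - t)",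
          OF assms(1) f(2) _ has_real_derivative_capped_cubic'])
  then have "Ck_on (Suc (Suc 0)) S (\<lambda>x. capped_cubic c (f x))"
    by (rule Ck_on_compose_Suc[where F = "capped_cubic c" and F' = "\<lambda>t. 3 * max 0 (c - t) ^ 2",
          OF assms(1) f(1) _ has_real_derivative_capped_cubic])
  then show ?thesis unfolding numeral_2_eq_2 .
qed

section \<open>Extension across the frontier of the neighbourhood\<close>

definition capped_extension :: "'a set \<Rightarrow> real \<Rightarrow> ('a \<Rightarrow> real) \<Rightarrow> 'a \<Rightarrow> real" where
  "capped_extension U c f x = (if x \<in> U then capped_cubic c (f x) else c ^ 3)"

text \<open>Near a point of \<open>K\<close> the extension is either the smooth composition, inside \<open>U\<close>, or the constant
  \<open>c^3\<close>: outside the closure of \<open>U\<close> by definition, and at the frontier of \<open>U\<close> because the cap is already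
  in force on the part of a ball that lies in \<open>U\<close>.\<close>

lemma Ck_on_capped_extension:
  fixes f :: "'a::real_normed_vector \<Rightarrow> real"
  assumes "open U" "Ck_on 2 U f"
    and above: "\<And>x. x \<in> frontier U \<inter> K \<Longrightarrow> \<exists>r>0. \<forall>y \<in> U \<inter> ball x r. c < f y"
  shows "\<exists>W. open W \<and> K \<subseteq> W \<and> Ck_on 2 W (capped_extension U c f)"
proof -
  let ?\<Phi> = "capped_extension U c f"
  define W where "W = \<Union>{T. open T \<and> Ck_on 2 T ?\<Phi>}"
  have "open W" by (auto simp: W_def)
  moreover have "Ck_on 2 W ?\<Phi>" by (rule Ck_on_local) (auto simp: W_def)
  moreover have "x \<in> W" if K: "x \<in> K" for x
  proof -
    have const: "Ck_on 2 T ?\<Phi>" if "open T" "\<And>y. y \<in> T \<Longrightarrow> ?\<Phi> y = c ^ 3" for T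
      by (rule Ck_on_cong[OF \<open>open T\<close> _ Ck_on_const[of 2 T "c ^ 3"]]) (simp add: that)
    consider "x \<in> U" | "x \<in> frontier U" | "x \<in> - closure U"
      using closure_Un_frontier by blast
    then show ?thesis
    proof cases
      case 1
      have "Ck_on 2 U ?\<Phi>"
        by (rule Ck_on_cong[OF \<open>open U\<close> _ Ck_on_capped_cubic[OF \<open>open U\<close> \<open>Ck_on 2 U f\<close>, of c]])
          (simp add: capped_extension_def)
      then show ?thesis using 1 \<open>open U\<close> by (auto simp: W_def)
    next
      case 2
      then obtain r where r: "r > 0" "\<And>y. y \<in> U \<Longrightarrow> y \<in> ball x r \<Longrightarrow> c < f y"
        using above[of x] K by auto
      have "Ck_on 2 (ball x r) ?\<Phi>"
        by (rule const) (use r in \<open>auto simp: capped_extension_def capped_cubic_of_ge less_imp_le\<close>)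
      then show ?thesis using r(1) unfolding W_def by (blast intro: centre_in_ball[THEN iffD2])
    next
      case 3
      have "Ck_on 2 (- closure U) ?\<Phi>"
        by (rule const) (use closure_subset[of U] in \<open>auto simp: capped_extension_def\<close>)
      then show ?thesis using 3 unfolding W_def by (blast intro: open_Compl)
    qed
  qed
  ultimately show ?thesis by blast
qed

text \<open>The continuous extensions guarantee that the limits exist, so that \<open>Lim\<close> is not an arbitrary value and
  each bound \<open>a i\<close> holds near \<open>x\<close>; positivity of the bounds lets them be multiplied.\<close>

lemma prod_gt_near_frontier:
  fixes f :: "nat \<Rightarrow> 'a::metric_space \<Rightarrow> real"
  assumes "open U" "x \<in> frontier U" "finite I"
    and ext: "\<And>i. i \<in> I \<Longrightarrow> extends_continuously U (f i)"
    and lim: "\<And>i. i \<in> I \<Longrightarrow> Lim (at x within U) (f i) > a i"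
    and pos: "\<And>i. i \<in> I \<Longrightarrow> a i > 0" and "c < (\<Prod>i\<in>I. a i)"
  shows "\<exists>r>0. \<forall>y \<in> U \<inter> ball x r. c < (\<Prod>i\<in>I. f i y)"
proof -
  have x: "x \<in> closure U" "x \<notin> U"
    using assms(1,2) by (auto simp: frontier_def interior_open)
  then have nontriv: "at x within U \<noteq> bot"
    by (simp add: trivial_limit_within islimpt_in_closure)
  have "\<forall>\<^sub>F y in at x within U. a i < f i y" if i: "i \<in> I" for i
  proof -
    obtain g where g: "continuous_on (closure U) g" "\<And>y. y \<in> U \<Longrightarrow> g y = f i y"
      using ext[OF i] by (auto simp: extends_continuously_def)
    have "(g \<longlongrightarrow> g x) (at x within U)"
      using g(1)[unfolded continuous_on_def, rule_format, OF x(1)] closure_subset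
      by (rule tendsto_within_subset)
    then have f: "(f i \<longlongrightarrow> g x) (at x within U)"
      by (rule Lim_transform_within[OF _ zero_less_one]) (simp add: g)
    then have "Lim (at x within U) (f i) = g x" by (rule tendsto_Lim[OF nontriv])
    then show ?thesis using lim[OF i] f by (simp add: order_tendstoD)
  qed
  then have "\<forall>\<^sub>F y in at x within U. \<forall>i\<in>I. a i < f i y"
    using \<open>finite I\<close> by (simp add: eventually_ball_finite)
  then obtain r where r: "r > 0" "\<And>y i. y \<in> U \<Longrightarrow> y \<noteq> x \<Longrightarrow> dist y x < r \<Longrightarrow> i \<in> I \<Longrightarrow> a i < f i y"
    by (auto simp: eventually_at)
  have "c < (\<Prod>i\<in>I. f i y)" if "y \<in> U \<inter> ball x r" for y
  proof -
    have "(\<Prod>i\<in>I. a i) \<le> (\<Prod>i\<in>I. f i y)"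
      using less_imp_le[OF pos] less_imp_le[OF r(2)[of y]] that x(2)
      by (intro prod_mono) (auto simp: dist_commute)
    then show ?thesis using \<open>c < _\<close> by linarith
  qed
  then show ?thesis using r(1) by blast
qed

section \<open>The interface\<close>

text \<open>Disjoint open sets avoid each other's closures, so the common boundary \<open>\<Gamma>\<close> is all of the boundary of
  \<open>A\<close> inside \<open>\<Omega>\<close>.\<close>

lemma interface_eq_frontier:
  assumes "open A" "open B" "A \<inter> B = {}" "\<Omega> = A \<union> B \<union> \<Gamma>" "closure B \<inter> closure A = \<Gamma>"
  shows "\<Gamma> \<inter> A = {}" "\<Gamma> \<inter> B = {}" "\<Gamma> = frontier A \<inter> \<Omega>"
proof -
  have "closure B \<inter> A = {}" "closure A \<inter> B = {}"
    using assms(3) open_Int_closure_eq_empty[OF assms(1), of B] open_Int_closure_eq_empty[OF assms(2), of A]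
    by (simp_all add: Int_commute)
  then show "\<Gamma> \<inter> A = {}" "\<Gamma> \<inter> B = {}" "\<Gamma> = frontier A \<inter> \<Omega>"
    using assms by (auto simp: frontier_def interior_open)
qed

lemma in_frontier_of_factor:
  assumes "x \<in> closure (\<Inter>i\<in>I. S i)" "x \<notin> (\<Inter>i\<in>I. S i)" "\<And>i. i \<in> I \<Longrightarrow> open (S i)"
  shows "\<exists>i\<in>I. x \<in> frontier (S i)"
proof -
  obtain i where i: "i \<in> I" "x \<notin> S i" using assms(2) by blast
  have "x \<in> closure (S i)" using assms(1) closure_mono[of "\<Inter>i\<in>I. S i" "S i"] i(1) by blast
  then show ?thesis using i assms(3) by (auto simp: frontier_def interior_open)
qed

text \<open>At a point of only one face, all the other factors \<open>S j\<close> of the intersection contain a neighbourhood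
  of the point. There \<open>A\<close> coincides with \<open>S i\<close>, and the defining function of the smooth hypersurface \<open>M i\<close>
  is one of \<open>\<Gamma>\<close>; the outer side \<open>B\<close> is what remains of \<open>\<Omega>\<close>.\<close>

lemma has_unit_normal_on_single_face:
  fixes A B :: "(real^'d) set"
  assumes opn: "open \<Omega>" "open A" "open B"
    and dec: "A \<inter> B = {}" "\<Omega> = A \<union> B \<union> \<Gamma>" "closure B \<inter> closure A = \<Gamma>"
    and A: "A = (\<Inter>i\<in>I. S i)" "finite I"
    and S: "\<And>j. j \<in> I \<Longrightarrow> open (S j)"
    and i: "i \<in> I" "oriented_smooth_hypersurface (M i) (S i)" "x \<in> M i"
    and x: "x \<in> \<Gamma>" "\<And>j. j \<in> I - {i} \<Longrightarrow> x \<notin> frontier (S j)"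
  shows "has_unit_normal \<Gamma> A B x"
proof -
  note \<Gamma> = interface_eq_frontier[OF opn(2,3) dec]
  obtain V g where V: "open V" "x \<in> V" "smooth_on V g" "\<forall>y\<in>V. grad g y \<noteq> 0"
      "M i \<inter> V = {y \<in> V. g y = 0}" "S i \<inter> V = {y \<in> V. g y < 0}"
    using i(2)[unfolded oriented_smooth_hypersurface_def] i(3) by meson
  have M: "M i = frontier (S i)"
    using i(2)[unfolded oriented_smooth_hypersurface_def] by simp
  have cl: "closure A \<subseteq> closure (S j)" if "j \<in> I" for j
    using A that by (intro closure_mono) auto
  have inS: "x \<in> S j" if "j \<in> I - {i}" for j
  proof -
    have "x \<in> closure (S j)" using cl that x(1) dec(3) by blast
    then show ?thesis using x(2)[OF that] by (auto simp: closure_Un_frontier)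
  qed
  define N where "N = V \<inter> \<Omega> \<inter> (\<Inter>j\<in>I - {i}. S j)"
  have N: "open N" "x \<in> N" "N \<subseteq> V" "N \<subseteq> \<Omega>"
    using V(1,2) opn(1) A(2) S inS x(1) dec(2) unfolding N_def
    by (auto intro!: open_Int open_INT)
  have AN: "A \<inter> N = S i \<inter> N" using A(1) i(1) by (auto simp: N_def)
  have gA: "y \<in> A \<longleftrightarrow> g y < 0" if "y \<in> N" for y
    using that AN V(6) N(3) by blast
  have g\<Gamma>: "y \<in> \<Gamma> \<longleftrightarrow> g y = 0" if y: "y \<in> N" for y
  proof
    assume "y \<in> \<Gamma>"
    then have "y \<in> closure (S i)" using cl[OF i(1)] dec(3) by blast
    moreover have "y \<notin> S i" using \<open>y \<in> \<Gamma>\<close> \<Gamma>(1) AN y by blast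
    ultimately have "y \<in> M i" unfolding M by (auto simp: closure_Un_frontier)
    then show "g y = 0" using V(5) N(3) y by blast
  next
    assume "g y = 0"
    then have "y \<in> frontier (S i)" using V(5) N(3) y unfolding M[symmetric] by blast
    then have "y \<in> closure (N \<inter> S i)"
      using open_Int_closure_subset[OF N(1), of "S i"] y by (auto simp: frontier_def)
    then have "y \<in> closure A" using AN closure_mono[of "N \<inter> S i" A] by blast
    moreover have "y \<notin> A" using gA y \<open>g y = 0\<close> by simp
    ultimately show "y \<in> \<Gamma>"
      using N(4) y opn(2) unfolding \<Gamma>(3) by (auto simp: frontier_def interior_open)
  qed
  have gB: "y \<in> B \<longleftrightarrow> g y > 0" if "y \<in> N" for y
  proof -
    have "y \<in> B \<longleftrightarrow> y \<notin> A \<and> y \<notin> \<Gamma>" using that N(4) dec(1,2) \<Gamma>(2) by blast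
    then show ?thesis unfolding gA[OF that] g\<Gamma>[OF that] by linarith
  qed
  have "Ck_on 1 N g" using V(3) Ck_on_subset[OF _ N(3)] unfolding smooth_on_def by blast
  moreover have "\<Gamma> \<inter> N = {y \<in> N. g y = 0}" "A \<inter> N = {y \<in> N. g y < 0}" "B \<inter> N = {y \<in> N. g y > 0}"
    using gA gB g\<Gamma> by blast+
  moreover have "\<forall>y\<in>N. grad g y \<noteq> 0" using V(4) N(3) by blast
  ultimately have "unit_normal_at \<Gamma> A B x (grad g x /\<^sub>R norm (grad g x))"
    unfolding unit_normal_at_def using N(1,2) x(1) by blast
  then show ?thesis unfolding has_unit_normal_def by blast
qed

section \<open>The lifting function\<close>

theorem theorem3p7:
  fixes \<Omega> \<Omega>m \<Omega>p \<Gamma> U :: "(real^'d) set"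
    and \<beta> :: "real^'d \<Rightarrow> real" and \<beta>m \<beta>p :: real
    and nrm :: "real^'d \<Rightarrow> real^'d"
    and n :: nat
    and M Int_M :: "nat \<Rightarrow> (real^'d) set"
    and \<psi>s :: "nat \<Rightarrow> real^'d \<Rightarrow> real" and \<psi> :: "real^'d \<Rightarrow> real"
    and cs :: "nat \<Rightarrow> real" and c :: real
  assumes dim: "CARD('d) = 2 \<or> CARD('d) = 3"
    and Omega: "domain \<Omega>" "bounded \<Omega>" "lipschitz_boundary \<Omega>"
    and subdomains: "domain \<Omega>m" "domain \<Omega>p" "\<Omega>m \<inter> \<Omega>p = {}"
    and Gamma: "\<Gamma> \<subseteq> \<Omega>" "oriented_embedded_interface \<Gamma> \<Omega>m \<Omega>p"
    and decomposition: "\<Omega> = \<Omega>m \<union> \<Omega>p \<union> \<Gamma>" "closure \<Omega>p \<inter> closure \<Omega>m = \<Gamma>"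
    and beta: "\<beta>m > 0" "\<beta>p > 0" "\<forall>x\<in>\<Omega>m. \<beta> x = \<beta>m" "\<forall>x\<in>\<Omega>p. \<beta> x = \<beta>p"
    and normal: "\<forall>x\<in>\<Gamma>. has_unit_normal \<Gamma> \<Omega>m \<Omega>p x \<longrightarrow> unit_normal_at \<Gamma> \<Omega>m \<Omega>p x (nrm x)"
    and A1: "n \<ge> 1" "\<forall>i\<in>{1..n}. oriented_smooth_hypersurface (M i) (Int_M i)"
      "\<Omega>m = (\<Inter>i\<in>{1..n}. Int_M i)"
      "\<forall>i\<in>{1..n}. \<forall>j\<in>{1..n}. i \<noteq> j \<longrightarrow> surface_measure (M i \<inter> M j) = 0"
    and A2: "open U" "\<Gamma> \<subseteq> U"
      "\<forall>i\<in>{1..n}. Ck_closure 2 U (\<psi>s i)"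
      "\<forall>i\<in>{1..n}. \<forall>x\<in>\<Gamma>. \<psi>s i x = 0 \<longleftrightarrow> x \<in> M i"
      "\<forall>i\<in>{1..n}. \<forall>x\<in>U \<inter> \<Omega>m. \<psi>s i x > 0"
      "\<forall>i\<in>{1..n}. \<forall>x\<in>M i \<inter> \<Gamma>. has_unit_normal \<Gamma> \<Omega>m \<Omega>p x \<longrightarrow> nrm x \<bullet> grad (\<psi>s i) x \<noteq> 0"
    and A3: "\<forall>i\<in>{1..n}. cs i > 0"
      "\<forall>i\<in>{1..n}. \<forall>x\<in>frontier U \<inter> closure \<Omega>m. Lim (at x within U) (\<psi>s i) > cs i"
    and psi: "\<forall>x\<in>U. \<psi> x = (\<Prod>i=1..n. \<psi>s i x)"
    and c: "0 < c" "c < (\<Prod>i=1..n. cs i)"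
  shows "(\<forall>x\<in>closure \<Omega>. \<exists>!y. prescribed_value \<Omega>m \<Omega>p U \<psi> c x y) \<and>
    (\<forall>\<phi>. (\<forall>x\<in>closure \<Omega>. prescribed_value \<Omega>m \<Omega>p U \<psi> c x (\<phi> x)) \<longrightarrow>
      continuous_on (closure \<Omega>) \<phi> \<and>
      Ck_closure 2 \<Omega>p \<phi> \<and>
      Ck_closure 2 \<Omega>m \<phi> \<and>
      (\<forall>x\<in>\<Gamma>. has_jump \<Omega>m \<Omega>p \<phi> x 0) \<and>
      ae_on \<Gamma> (\<lambda>x. has_unit_normal \<Gamma> \<Omega>m \<Omega>p x \<and>
        (\<exists>J. has_flux_jump \<Omega>m \<Omega>p \<beta>m \<beta>p (nrm x) \<phi> x J \<and> J \<noteq> 0)))"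
proof -
  define f where "f x = (\<Prod>i=1..n. \<psi>s i x)" for x
  define \<Phi> where "\<Phi> = capped_extension U c f"
  have opn: "open \<Omega>" "open \<Omega>m" "open \<Omega>p"
    using Omega(1) subdomains(1,2) by (auto simp: domain_def)
  note \<Gamma> = interface_eq_frontier[OF opn(2,3) subdomains(3) decomposition]
  have I: "open (Int_M i)" "frontier (Int_M i) = M i" if "i \<in> {1..n}" for i
    using A1(2) that unfolding oriented_smooth_hypersurface_def by blast+
  have face: "\<exists>i\<in>{1..n}. x \<in> M i" if "x \<in> \<Gamma>" for x
    using in_frontier_of_factor[of x Int_M "{1..n}"] that \<Gamma>(1) decomposition(2) A1(3) I by blast
  have f0: "f x = 0" if "x \<in> \<Gamma>" for x
    using face[OF that] A2(4) that unfolding f_def by (auto intro!: prod_zero)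
  have \<Phi>0: "\<Phi> x = 0" if "x \<in> \<Gamma>" for x
    using that A2(2) f0[OF that] c(1) by (auto simp: \<Phi>_def capped_extension_def capped_cubic_of_le)

  have cl_\<Omega>: "closure \<Omega> = closure \<Omega>m \<union> closure \<Omega>p"
  proof
    have "\<Omega> \<subseteq> closure \<Omega>m \<union> closure \<Omega>p"
      using decomposition closure_subset[of \<Omega>m] closure_subset[of \<Omega>p] by blast
    then show "closure \<Omega> \<subseteq> closure \<Omega>m \<union> closure \<Omega>p" by (rule closure_minimal) auto
    show "closure \<Omega>m \<union> closure \<Omega>p \<subseteq> closure \<Omega>"
      using decomposition(1) by (intro Un_least closure_mono) auto
  qed
  have prescribed: "prescribed_value \<Omega>m \<Omega>p U \<psi> c x y \<longleftrightarrow> y = (if x \<in> closure \<Omega>m then \<Phi> x else 0)"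
    if "x \<in> closure \<Omega>" for x y
  proof -
    have "x \<in> closure \<Omega>m \<or> x \<in> closure \<Omega>p"
      using that cl_\<Omega> by blast
    moreover have "\<psi> x = f x" if "x \<in> U" using psi that by (simp add: f_def)
    moreover have "x \<in> U \<and> f x = 0" if "x \<in> closure \<Omega>m" "x \<in> closure \<Omega>p"
      using that decomposition(2) A2(2) f0 by blast
    ultimately show ?thesis using c(1)
      unfolding prescribed_value_def superlevel_set_def \<Phi>_def capped_extension_def
      by (cases "x \<in> closure \<Omega>m"; cases "x \<in> closure \<Omega>p"; cases "x \<in> U"; cases "c \<le> f x")
        (auto simp: capped_cubic_of_ge capped_cubic_of_le)
  qed

  have \<psi>s: "Ck_on 2 U (\<psi>s i)" "extends_continuously U (\<psi>s i)" if "i \<in> {1..n}" for i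
  proof -
    have "Ck_closure 2 U (\<psi>s i)" using A2(3) that by blast
    then show "Ck_on 2 U (\<psi>s i)" by (rule Ck_closure_imp_Ck_on)
    show "extends_continuously U (\<psi>s i)"
      using \<open>Ck_closure 2 U (\<psi>s i)\<close> by (simp add: numeral_2_eq_2)
  qed
  have f2: "Ck_on 2 U f" unfolding f_def[abs_def] using \<psi>s A2(1) by (intro Ck_on_prod)
  have "\<exists>W. open W \<and> closure \<Omega>m \<subseteq> W \<and> Ck_on 2 W \<Phi>"
    unfolding \<Phi>_def using A2(1) f2
  proof (rule Ck_on_capped_extension)
    show "\<exists>r>0. \<forall>y \<in> U \<inter> ball x r. c < f y" if "x \<in> frontier U \<inter> closure \<Omega>m" for x
      unfolding f_def using A2(1)
    proof (rule prod_gt_near_frontier)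
      show "x \<in> frontier U" using that by simp
      show "cs i < Lim (at x within U) (\<psi>s i)" "0 < cs i" if "i \<in> {1..n}" for i
        using A3 that \<open>x \<in> frontier U \<inter> closure \<Omega>m\<close> by blast+
    qed (use \<psi>s c in auto)
  qed
  then obtain W where W: "open W" "closure \<Omega>m \<subseteq> W" "Ck_on 2 W \<Phi>" by blast
  have \<Phi>1: "Ck_on (Suc 0) W \<Phi>" "continuous_on W \<Phi>"
    using Ck_on_antimono[OF W(3), of "Suc 0"] Ck_on_antimono[OF W(3), of 0] by auto

  have grad\<Phi>: "grad \<Phi> x = (3 * c ^ 2 * (\<Prod>j\<in>{1..n} - {i}. \<psi>s j x)) *\<^sub>R grad (\<psi>s i) x"
    if "x \<in> \<Gamma>" "i \<in> {1..n}" "x \<in> M i" for x i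
  proof -
    have U: "x \<in> U" using that A2(2) by blast
    have diff: "f differentiable at x" "\<And>j. j \<in> {1..n} \<Longrightarrow> \<psi>s j differentiable at x"
      using f2 \<psi>s U by (auto simp: numeral_2_eq_2)
    have d: "(capped_cubic c has_real_derivative 3 * c ^ 2) (at (f x))"
      using has_real_derivative_capped_cubic[of c "f x"] f0[OF that(1)] c(1) by simp
    have "(\<lambda>y. capped_cubic c (f y)) differentiable at x"
      using Ck_on_capped_cubic[OF A2(1) f2] U by (auto simp: numeral_2_eq_2)
    then have "grad \<Phi> x = grad (\<lambda>y. capped_cubic c (f y)) x"
      using A2(1) U by (rule grad_cong) (simp add: \<Phi>_def capped_extension_def)
    also have "\<dots> = (3 * c ^ 2) *\<^sub>R grad f x" by (rule grad_compose[OF d diff(1)])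
    also have "grad f x = (\<Prod>j\<in>{1..n} - {i}. \<psi>s j x) *\<^sub>R grad (\<psi>s i) x"
      unfolding f_def[abs_def] using that A2(4) diff(2) by (intro grad_prod_of_zero) auto
    finally show ?thesis by simp
  qed

  \<comment> \<open>The exceptional set: corners and edges, where several faces meet.\<close>
  define E where "E = (\<Union>i\<in>{1..n}. \<Union>j\<in>{1..n} - {i}. M i \<inter> M j)"
  have E0: "surface_measure E = 0"
  proof -
    \<comment> \<open>The finitely many intersections as a sequence, padded with empty sets.\<close>
    define P where "P k = (case prod_decode k of (i, j) \<Rightarrow>
        if i \<in> {1..n} \<and> j \<in> {1..n} - {i} then M i \<inter> M j else {})" for k
    have s: "1 \<le> CARD('d) - 1" using dim by auto
    have "hausdorff_measure (CARD('d) - 1) (P k) = 0" for k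
      using A1(4) hausdorff_measure_empty[OF s]
      by (auto simp: P_def surface_measure_def split: prod.split)
    then have "hausdorff_measure (CARD('d) - 1) (\<Union>k. P k) = 0" by (rule hausdorff_measure_UN_eq_0)
    moreover have "E \<subseteq> (\<Union>k. P k)"
    proof
      fix x assume "x \<in> E"
      then obtain i j where "i \<in> {1..n}" "j \<in> {1..n} - {i}" "x \<in> M i \<inter> M j"
        unfolding E_def by blast
      then have "x \<in> P (prod_encode (i, j))" by (simp add: P_def)
      then show "x \<in> (\<Union>k. P k)" by blast
    qed
    ultimately show ?thesis
      using hausdorff_measure_mono[of E "\<Union>k. P k" "CARD('d) - 1"]
      unfolding surface_measure_def by simp
  qed

  have "continuous_on (closure \<Omega>) \<phi> \<and> Ck_closure 2 \<Omega>p \<phi> \<and> Ck_closure 2 \<Omega>m \<phi> \<and>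
      (\<forall>x\<in>\<Gamma>. has_jump \<Omega>m \<Omega>p \<phi> x 0) \<and>
      ae_on \<Gamma> (\<lambda>x. has_unit_normal \<Gamma> \<Omega>m \<Omega>p x \<and>
        (\<exists>J. has_flux_jump \<Omega>m \<Omega>p \<beta>m \<beta>p (nrm x) \<phi> x J \<and> J \<noteq> 0))"
    if \<phi>: "\<forall>x\<in>closure \<Omega>. prescribed_value \<Omega>m \<Omega>p U \<psi> c x (\<phi> x)" for \<phi>
  proof -
    have sub: "closure \<Omega>m \<subseteq> closure \<Omega>" "closure \<Omega>p \<subseteq> closure \<Omega>"
      using cl_\<Omega> by auto
    have \<phi>m: "\<phi> x = \<Phi> x" if "x \<in> closure \<Omega>m" for x
      using prescribed[of x "\<phi> x"] bspec[OF \<phi>, of x] that sub(1) by auto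
    have \<phi>p: "\<phi> x = 0" if "x \<in> closure \<Omega>p" for x
      using prescribed[of x "\<phi> x"] bspec[OF \<phi>, of x] that sub(2) \<Phi>0[of x] decomposition(2)
      by (cases "x \<in> closure \<Omega>m") auto
    have inm: "x \<in> closure \<Omega>m" if "x \<in> \<Omega>m" for x using that closure_subset by blast
    have inp: "x \<in> closure \<Omega>p" if "x \<in> \<Omega>p" for x using that closure_subset by blast

    have "continuous_on (closure \<Omega>m) \<phi>"
      using continuous_on_subset[OF \<Phi>1(2) W(2)] \<phi>m by (simp cong: continuous_on_cong)
    moreover have "continuous_on (closure \<Omega>p) \<phi>"
      using \<phi>p by (simp cong: continuous_on_cong)
    ultimately have cont: "continuous_on (closure \<Omega>) \<phi>"
      unfolding cl_\<Omega> by (intro continuous_on_closed_Un closed_closure)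
    moreover have "Ck_closure 2 \<Omega>p \<phi>"
      by (rule Ck_closure_cong[OF opn(3) _ Ck_on_imp_Ck_closure[OF Ck_on_const[of 2 UNIV 0]]])
        (use \<phi>p inp in auto)
    moreover have "Ck_closure 2 \<Omega>m \<phi>"
      by (rule Ck_closure_cong[OF opn(2) _ Ck_on_imp_Ck_closure[OF W(3,2)]]) (use \<phi>m inm in auto)
    moreover have "has_jump \<Omega>m \<Omega>p \<phi> x 0" if "x \<in> \<Gamma>" for x
    proof -
      have "x \<in> closure \<Omega>" using that decomposition(2) sub by blast
      then have lim: "(\<phi> \<longlongrightarrow> \<phi> x) (at x within closure \<Omega>)"
        using cont by (simp add: continuous_on_def)
      have "\<Omega>p \<subseteq> closure \<Omega>" "\<Omega>m \<subseteq> closure \<Omega>" using inm inp sub by auto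
      then have "(\<phi> \<longlongrightarrow> \<phi> x) (at x within \<Omega>p)" "(\<phi> \<longlongrightarrow> \<phi> x) (at x within \<Omega>m)"
        by (auto intro: tendsto_within_subset[OF lim])
      then show ?thesis unfolding has_jump_def by (intro exI[of _ "\<phi> x"]) simp
    qed
    moreover have "has_unit_normal \<Gamma> \<Omega>m \<Omega>p x \<and>
        (\<exists>J. has_flux_jump \<Omega>m \<Omega>p \<beta>m \<beta>p (nrm x) \<phi> x J \<and> J \<noteq> 0)" if x: "x \<in> \<Gamma>" "x \<notin> E" for x
    proof -
      obtain i where i: "i \<in> {1..n}" "x \<in> M i" using face x(1) by blast
      have others: "x \<notin> M j" if "j \<in> {1..n} - {i}" for j
        using x(2) i that unfolding E_def by blast
      have normal: "has_unit_normal \<Gamma> \<Omega>m \<Omega>p x"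
      proof (rule has_unit_normal_on_single_face[where I = "{1..n}" and S = Int_M and M = M and i = i])
        show "x \<notin> frontier (Int_M j)" if "j \<in> {1..n} - {i}" for j
          using I(2)[of j] others[OF that] that by simp
      qed (use opn subdomains(3) decomposition A1(2,3) I(1) i x(1) in auto)

      have "grad \<phi> y = 0" if "y \<in> \<Omega>p" for y
      proof -
        have "grad \<phi> y = grad (\<lambda>_. 0) y"
          by (rule grad_cong[OF _ opn(3) that]) (use \<phi>p inp in auto)
        also have "\<dots> = 0"
          using frechet_derivative_at[OF has_derivative_const[of "0::real" "at y"], symmetric]
          by (simp add: grad_def vec_eq_iff)
        finally show ?thesis .
      qed
      then have limp: "((\<lambda>y. nrm x \<bullet> grad \<phi> y) \<longlongrightarrow> 0) (at x within \<Omega>p)"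
        by - (rule Lim_transform_within[OF tendsto_const zero_less_one], auto)

      have "x \<in> W" using x(1) decomposition(2) W(2) by blast
      then have "(grad \<Phi> \<longlongrightarrow> grad \<Phi> x) (at x within W)"
        using continuous_on_grad[OF \<Phi>1(1)] by (simp add: continuous_on_def)
      then have "(grad \<Phi> \<longlongrightarrow> grad \<Phi> x) (at x within \<Omega>m)"
        by (rule tendsto_within_subset) (use W(2) inm in blast)
      moreover have "grad \<phi> y = grad \<Phi> y" if "y \<in> \<Omega>m" for y
      proof (rule grad_cong[OF _ opn(2) that])
        show "\<Phi> differentiable at y" using \<Phi>1(1) W(2) inm[OF that] by auto
        show "\<Phi> z = \<phi> z" if "z \<in> \<Omega>m" for z using \<phi>m inm[OF that] by simp
      qed
      ultimately have "(grad \<phi> \<longlongrightarrow> grad \<Phi> x) (at x within \<Omega>m)"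
        by - (rule Lim_transform_within[OF _ zero_less_one], auto)
      then have limm: "((\<lambda>y. nrm x \<bullet> grad \<phi> y) \<longlongrightarrow> nrm x \<bullet> grad \<Phi> x) (at x within \<Omega>m)"
        by (intro tendsto_inner tendsto_const)

      have "(\<Prod>j\<in>{1..n} - {i}. \<psi>s j x) \<noteq> 0" using others A2(4) x(1) by auto
      moreover have "nrm x \<bullet> grad (\<psi>s i) x \<noteq> 0" using A2(6) normal i x(1) by blast
      ultimately have "\<beta>p * 0 - \<beta>m * (nrm x \<bullet> grad \<Phi> x) \<noteq> 0"
        using beta(1) c(1) grad\<Phi>[OF x(1) i] by auto
      then show ?thesis using normal limp limm unfolding has_flux_jump_def by blast
    qed
    then have "ae_on \<Gamma> (\<lambda>x. has_unit_normal \<Gamma> \<Omega>m \<Omega>p x \<and>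
        (\<exists>J. has_flux_jump \<Omega>m \<Omega>p \<beta>m \<beta>p (nrm x) \<phi> x J \<and> J \<noteq> 0))" (is "ae_on \<Gamma> ?Q")
    proof -
      assume "\<And>x. x \<in> \<Gamma> \<Longrightarrow> x \<notin> E \<Longrightarrow> ?Q x"
      then have "{x \<in> \<Gamma>. \<not> ?Q x} \<subseteq> E" by blast
      then show ?thesis
        using E0 hausdorff_measure_mono[of "{x \<in> \<Gamma>. \<not> ?Q x}" E "CARD('d) - 1"]
        unfolding ae_on_def surface_measure_def by simp
    qed
    ultimately show ?thesis by blast
  qed
  moreover have "\<exists>!y. prescribed_value \<Omega>m \<Omega>p U \<psi> c x y" if "x \<in> closure \<Omega>" for x
    using prescribed[OF that] by simp
  ultimately show ?thesis by blast
qed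

end
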